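(* Let $f=(f_1,\dots,f_n):\mathbb{R}^n\to\mathbb{R}^n$ be a real polynomial mapping which is $\mathcal{D}_0$, and let $[w,v_1,\dots,v_n]$ be a univariate representation of $\mathrm{Sol}(f)$. Suppose that sparse solutions of $\mathrm{CP}(f)$ have $k$ zero coordinates. Then $$\mathrm{Sol}_{\mathrm{sp}}(f)=\bigcup_{\ell\subseteq\{1,\dots,n\},\ \#\ell=k}\Big\{\big(v_1(t),\dots,v_n(t)\big): w_{\ell}(t)=0,\ w_{\bar\ell}(t)\neq0,\ t\in\mathbb{R}\Big\},$$ where $\bar\ell=\{1,\dots,n\}\setminus\ell$.
   Context: For a real polynomial mapping $f=(f_1,\dots,f_n):\mathbb{R}^n\to\mathbb{R}^n$, $\mathrm{Sol}(f)$ denotes the solution set of the polynomial complementarity problem $\mathrm{CP}(f)$, i.e. the set of $x\in\mathbb{R}^n$ with $x\ge0$, $f(x)\ge0$ (componentwise) and $\langle x\mid f(x)\rangle=0$ (usual scalar product). A sparse solution is a minimizer of $\|\alpha\|_0$ over $\alpha\in\mathrm{Sol}(f)$, where $\|\alpha\|_0$ is the number of nonzero coordinates of $\alpha$; the set of sparse solutions is $\mathrm{Sol}_{\mathrm{sp}}(f)$. $f$ is called $\mathcal{D}_0$ if the set $\{x\in\mathbb{C}^n:x_1f_1(x)=\dots=x_nf_n(x)=0\}$ is finite. With $x=(x_1,\dots,x_n)$ and $z=(z_1,\dots,z_{2n})$, $\mathcal{I}[f,z]$ is the ideal of $\mathbb{R}[x,z]$ generated by $x_if_i$, $z_i^2-x_i$,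 $z_{n+i}^2-f_i$, $i=1,\dots,n$, and $V_{\mathbb{C}}(\mathcal{I}[f,z])\subseteq\mathbb{C}^{3n}$ is its set of common complex zeros. A univariate representation of $\mathrm{Sol}(f)$ (for $f$ being $\mathcal{D}_0$) is a system $[w,v_1,\dots,v_n]\subset\mathbb{R}[t]$ with $\deg w=\#V_{\mathbb{C}}(\mathcal{I}[f,z])$, $\deg v_i<\deg w$ for all $i$, and $\mathrm{Sol}(f)=\{(v_1(t),\dots,v_n(t)): w(t)=0,\ t\in\mathbb{R}\}$. For $\ell\subseteq\{1,\dots,n\}$, $w_\ell:=\gcd(w,\,v_i,\ i\in\ell)$ denotes the greatest common divisor in $\mathbb{R}[t]$ of $w$ and the $v_i$, $i\in\ell$.
   Formalization: The condition w_ℓ̄(t) ≠ 0 is imposed only when ℓ̄ is nonempty: for k = n the printed formula gives the empty set because w_∅ = w, although Sol_sp(f) = {0} (e.g. n = 1, f = x + 1). *)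

theory Defs
  imports
    "HOL-Analysis.Analysis"
    "HOL-Library.Poly_Mapping"
    "HOL-Computational_Algebra.Polynomial_Factorial"
    "HOL-Computational_Algebra.Field_as_Ring"
begin

text \<open>Polynomials with coefficients in \<open>'a\<close> and variables indexed by \<open>'v\<close>: a finitely
  supported function from monomials (finitely supported exponent functions) to coefficients.
  The ring structure is that of \<^theory>\<open>HOL-Library.Poly_Mapping\<close>.\<close>

type_synonym ('v, 'a) mpol = "('v \<Rightarrow>\<^sub>0 nat) \<Rightarrow>\<^sub>0 'a"

definition mpvar :: "'v \<Rightarrow> ('v, 'a::zero_neq_one) mpol" where
  "mpvar i = Poly_Mapping.single (Poly_Mapping.single i 1) 1"

definition mpconst :: "'a::zero \<Rightarrow> ('v, 'a) mpol" where
  "mpconst c = Poly_Mapping.single 0 c"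

text \<open>Substitution of ring elements \<open>x i\<close> for the variables, where \<open>h\<close> embeds the coefficients
  into the target ring.\<close>

definition mpsubst :: "('a::zero \<Rightarrow> 'r::comm_semiring_1) \<Rightarrow> ('v \<Rightarrow> 'r) \<Rightarrow> ('v, 'a) mpol \<Rightarrow> 'r" where
  "mpsubst h x p =
     (\<Sum>m\<in>Poly_Mapping.keys p. h (Poly_Mapping.lookup p m) *
        (\<Prod>i\<in>Poly_Mapping.keys m. x i ^ Poly_Mapping.lookup m i))"

text \<open>Value of a real polynomial at a real or complex point.\<close>

definition mpeval :: "('v::finite, real) mpol \<Rightarrow> 'r::{comm_semiring_1,real_algebra_1} ^ 'v \<Rightarrow> 'r" where
  "mpeval p x = mpsubst of_real (\<lambda>i. x $ i) p"

definition mpideal :: "('v, 'a::comm_ring_1) mpol set \<Rightarrow> ('v, 'a) mpol set" where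
  "mpideal G = module.span (*) G"

definition complex_zeros :: "('v::finite, real) mpol set \<Rightarrow> (complex ^ 'v) set" where
  "complex_zeros I = {a. \<forall>p\<in>I. mpeval p a = 0}"

text \<open>A real polynomial mapping on \<open>real ^ 'n\<close> is given by its components
  \<open>f :: 'n \<Rightarrow> ('n, real) mpol\<close>.\<close>

definition polymap :: "('n::finite \<Rightarrow> ('n, real) mpol) \<Rightarrow> real ^ 'n \<Rightarrow> real ^ 'n" where
  "polymap f x = (\<chi> i. mpeval (f i) x)"

definition Sol :: "('n::finite \<Rightarrow> ('n, real) mpol) \<Rightarrow> (real ^ 'n) set" where
  "Sol f = {x. (\<forall>i. 0 \<le> x $ i) \<and> (\<forall>i. 0 \<le> polymap f x $ i) \<and> x \<bullet> polymap f x = 0}"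

definition l0norm :: "real ^ 'n::finite \<Rightarrow> nat" where
  "l0norm \<alpha> = card {i. \<alpha> $ i \<noteq> 0}"

definition Sol_sp :: "('n::finite \<Rightarrow> ('n, real) mpol) \<Rightarrow> (real ^ 'n) set" where
  "Sol_sp f = {\<alpha>. is_arg_min l0norm (\<lambda>x. x \<in> Sol f) \<alpha>}"

definition D0 :: "('n::finite \<Rightarrow> ('n, real) mpol) \<Rightarrow> bool" where
  "D0 f \<longleftrightarrow> finite {x :: complex ^ 'n. \<forall>i. x $ i * mpeval (f i) x = 0}"

text \<open>The variables \<open>x\<^sub>1,\<dots>,x\<^sub>n, z\<^sub>1,\<dots>,z\<^sub>2\<^sub>n\<close> are indexed by \<open>'n + 'n + 'n\<close>:
  \<open>Inl i\<close> stands for \<open>x\<^sub>i\<close>, \<open>Inr (Inl i)\<close> for \<open>z\<^sub>i\<close>, and \<open>Inr (Inr i)\<close> for \<open>z\<close> with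
  index \<open>n + i\<close>.\<close>

definition xvar :: "'n \<Rightarrow> ('n + 'n + 'n, real) mpol" where
  "xvar i = mpvar (Inl i)"

definition zvar1 :: "'n \<Rightarrow> ('n + 'n + 'n, real) mpol" where
  "zvar1 i = mpvar (Inr (Inl i))"

definition zvar2 :: "'n \<Rightarrow> ('n + 'n + 'n, real) mpol" where
  "zvar2 i = mpvar (Inr (Inr i))"

text \<open>The inclusion of the polynomials in \<open>x\<close> into the polynomials in \<open>x, z\<close>.\<close>

definition lift_x :: "('n, real) mpol \<Rightarrow> ('n + 'n + 'n, real) mpol" where
  "lift_x p = mpsubst mpconst xvar p"

definition ideal_fz :: "('n \<Rightarrow> ('n, real) mpol) \<Rightarrow> ('n + 'n + 'n, real) mpol set" where
  "ideal_fz f = mpideal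
     ((\<Union>i. {xvar i * lift_x (f i), (zvar1 i)\<^sup>2 - xvar i, (zvar2 i)\<^sup>2 - lift_x (f i)}))"

definition curve_point :: "('n::finite \<Rightarrow> real poly) \<Rightarrow> real \<Rightarrow> real ^ 'n" where
  "curve_point v t = (\<chi> i. poly (v i) t)"

text \<open>The variety of \<open>ideal_fz f\<close> contains a point above \<open>x = 0\<close> and is finite if \<open>D0 f\<close> holds,
  so then the condition on \<open>degree w\<close> forces \<open>w\<close> to be nonconstant; in particular the convention
  \<open>degree 0 = 0\<close> is harmless.\<close>

definition univariate_rep ::
  "('n::finite \<Rightarrow> ('n, real) mpol) \<Rightarrow> real poly \<Rightarrow> ('n \<Rightarrow> real poly) \<Rightarrow> bool" where
  "univariate_rep f w v \<longleftrightarrow>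
     degree w = card (complex_zeros (ideal_fz f)) \<and>
     (\<forall>i. degree (v i) < degree w) \<and>
     Sol f = {curve_point v t |t. poly w t = 0}"

definition w_gcd :: "real poly \<Rightarrow> ('n \<Rightarrow> real poly) \<Rightarrow> 'n set \<Rightarrow> real poly" where
  "w_gcd w v l = Gcd (insert w (v ` l))"

text \<open>For the empty index set the gcd is \<open>w\<close> itself (up to a unit), so the conditions
  \<open>poly (w_gcd w v l) t = 0\<close> and \<open>poly (w_gcd w v (- l)) t \<noteq> 0\<close> contradict each other when
  \<open>l = UNIV\<close>. The condition on the complement expresses that some coordinate outside \<open>l\<close> does
  not vanish, and is to be imposed only if there are coordinates outside \<open>l\<close>.\<close>

lemma w_gcd_complement_UNIV:
  "\<not> (\<exists>t. poly (w_gcd w v UNIV) t = 0 \<and> poly (w_gcd w v (- UNIV)) t \<noteq> 0)"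
proof -
  have "w_gcd w v UNIV dvd w"
    unfolding w_gcd_def by (rule Gcd_dvd) simp
  hence "w_gcd w v UNIV dvd w_gcd w v (- UNIV)"
    by (simp add: w_gcd_def)
  thus ?thesis
    by (auto elim!: dvdE)
qed

end

theory Submission
  imports Defs
begin

text \<open>A real number is a root of a gcd of real polynomials iff it is a common root, since both
  say that the linear factor \<open>X - t\<close> is a common divisor. So the roots of \<open>w_gcd w v l\<close> are the
  parameters \<open>t\<close> of solutions whose coordinates with indices in \<open>l\<close> vanish, and the condition on
  the complement says that, unless \<open>l\<close> is everything, some coordinate outside \<open>l\<close> does not vanish.

  Minimizing the number of nonzero coordinates is the same as maximizing the number of zero
  coordinates, so \<open>k\<close> is the largest size of a set on which a solution can vanish. A sparse
  solution therefore occurs on the right-hand side for \<open>l\<close> its zero set. Conversely, a solution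
  vanishing on a set of size \<open>k\<close> has at least as many zeros as any sparse solution, hence is
  itself sparse. A sparse solution to compare with exists as soon as there is any solution;
  if there is none, both sides are empty for every \<open>k\<close>.\<close>

lemma poly_Gcd_eq_0_iff:
  fixes A :: "real poly set"
  shows "poly (Gcd A) t = 0 \<longleftrightarrow> (\<forall>p\<in>A. poly p t = 0)"
  by (simp add: poly_eq_0_iff_dvd dvd_Gcd_iff)

lemma poly_w_gcd_eq_0_iff:
  "poly (w_gcd w v l) t = 0 \<longleftrightarrow> poly w t = 0 \<and> (\<forall>i\<in>l. curve_point v t $ i = 0)"
  by (simp add: w_gcd_def poly_Gcd_eq_0_iff curve_point_def del: Gcd_insert)

lemma l0norm_add_card_zeros:
  fixes \<alpha> :: "real ^ 'n::finite"
  shows "l0norm \<alpha> + card {i. \<alpha> $ i = 0} = CARD('n)"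
proof -
  have "card ({i. \<alpha> $ i \<noteq> 0} \<union> {i. \<alpha> $ i = 0}) = l0norm \<alpha> + card {i. \<alpha> $ i = 0}"
    unfolding l0norm_def by (rule card_Un_disjoint) auto
  moreover have "{i. \<alpha> $ i \<noteq> 0} \<union> {i. \<alpha> $ i = 0} = UNIV" by auto
  ultimately show ?thesis by simp
qed

lemma l0norm_le_iff_card_zeros_ge:
  fixes \<alpha> \<beta> :: "real ^ 'n::finite"
  shows "l0norm \<alpha> \<le> l0norm \<beta> \<longleftrightarrow> card {i. \<beta> $ i = 0} \<le> card {i. \<alpha> $ i = 0}"
  using l0norm_add_card_zeros[of \<alpha>] l0norm_add_card_zeros[of \<beta>] by linarith

lemma Sol_sp_iff:
  "\<alpha> \<in> Sol_sp f \<longleftrightarrow>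
     \<alpha> \<in> Sol f \<and> (\<forall>\<beta>\<in>Sol f. card {i. \<beta> $ i = 0} \<le> card {i. \<alpha> $ i = 0})"
  by (auto simp: Sol_sp_def is_arg_min_linorder l0norm_le_iff_card_zeros_ge)

lemma Sol_sp_nonempty:
  assumes "\<beta> \<in> Sol f"
  shows "Sol_sp f \<noteq> {}"
  using ex_has_least_nat[of "\<lambda>x. x \<in> Sol f", OF assms, of l0norm]
  by (auto simp: Sol_sp_def is_arg_min_linorder)

theorem theorem4p4:
  fixes f :: "'n::finite \<Rightarrow> ('n, real) mpol"
    and w :: "real poly" and v :: "'n \<Rightarrow> real poly" and k :: nat
  assumes "D0 f"
    and "univariate_rep f w v"
    and "\<forall>\<alpha>\<in>Sol_sp f. card {i. \<alpha> $ i = 0} = k"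
  shows "Sol_sp f =
    (\<Union>l\<in>{l :: 'n set. card l = k}.
       {curve_point v t |t. poly (w_gcd w v l) t = 0 \<and>
          (- l \<noteq> {} \<longrightarrow> poly (w_gcd w v (- l)) t \<noteq> 0)})"
    (is "_ = ?R")
proof (intro equalityI subsetI)
  have Sol: "Sol f = {curve_point v t |t. poly w t = 0}"
    using assms(2) by (simp add: univariate_rep_def)
  show "\<alpha> \<in> ?R" if \<alpha>: "\<alpha> \<in> Sol_sp f" for \<alpha>
  proof -
    obtain t where t: "\<alpha> = curve_point v t" "poly w t = 0"
      using \<alpha> unfolding Sol_sp_iff Sol by blast
    define Z where "Z = {i. \<alpha> $ i = 0}"
    have "card Z = k"
      using assms(3) \<alpha> unfolding Z_def by blast
    moreover have "poly (w_gcd w v Z) t = 0"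
      using t by (simp add: poly_w_gcd_eq_0_iff Z_def)
    moreover have "poly (w_gcd w v (- Z)) t \<noteq> 0" if "- Z \<noteq> {}"
      using that t by (auto simp: poly_w_gcd_eq_0_iff Z_def)
    ultimately show ?thesis
      using t(1) by (intro UN_I[of Z] CollectI exI[of _ t]) simp_all
  qed
  show "\<alpha> \<in> Sol_sp f" if \<alpha>: "\<alpha> \<in> ?R" for \<alpha>
  proof -
    obtain l t where lt: "card l = k" "\<alpha> = curve_point v t" "poly (w_gcd w v l) t = 0"
      using \<alpha> by (elim UN_E CollectE exE conjE) simp
    have sol: "\<alpha> \<in> Sol f" and "l \<subseteq> {i. \<alpha> $ i = 0}"
      using lt Sol by (auto simp: poly_w_gcd_eq_0_iff)
    hence many_zeros: "k \<le> card {i. \<alpha> $ i = 0}"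
      using lt(1) card_mono[of "{i. \<alpha> $ i = 0}" l] by simp
    obtain \<gamma> where \<gamma>: "\<gamma> \<in> Sol_sp f"
      using Sol_sp_nonempty[OF sol] by blast
    hence "card {i. \<gamma> $ i = 0} = k"
      using assms(3) by blast
    moreover have "\<forall>\<beta>\<in>Sol f. card {i. \<beta> $ i = 0} \<le> card {i. \<gamma> $ i = 0}"
      using \<gamma> unfolding Sol_sp_iff by blast
    ultimately have "\<forall>\<beta>\<in>Sol f. card {i. \<beta> $ i = 0} \<le> card {i. \<alpha> $ i = 0}"
      using many_zeros by fastforce
    thus ?thesis
      using sol unfolding Sol_sp_iff by blast
  qed
qed

end
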